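(* For all $n,k\geq1$, the number of permutations $\pi\in\mathfrak{J}_n$ whose last letter $\pi_n$ equals $k$ is the Entringer number $E_{n,k}$. Consequently, the distribution of the last letter over $\mathfrak{J}_n$ equals the distribution of the first letter over the up-down permutations in $\mathfrak{S}_n$, and also equals the distribution of the first letter over the André permutations in $\mathfrak{S}_n$.
   Context: A permutation of a finite set $S$ of positive integers is a word in which each element of $S$ appears exactly once; $\mathfrak{S}_n$ is the set of permutations of $\{1,\dots,n\}$. For a permutation $\pi$ and a letter $x$ of $\pi$, $\rho_\pi(x)$ is the maximal consecutive subword of $\pi$ consisting of the letters immediately to the right of $x$ that are all larger than $x$. $\pi$ is Jacobi if $|\rho_\pi(x)|$ is even for all letters $x$; $\mathfrak{J}_n$ is the set of Jacobi permutations in $\mathfrak{S}_n$. A permutation $\pi$ is up-down if $\pi_1<\pi_2>\pi_3<\pi_4>\cdots$. The Entringer number $E_{n,k}$ is the number of up-down permutations $\pi\in\mathfrak{S}_n$ with $\pi_1=k$. André permutations are defined recursively: the empty permutation is André; for nonempty $S$ with $y=\min S$, a permutation $\pi=\alpha y\beta$ of $S$ is André if $\alpha$ and $\beta$ are André and the largest letter of the concatenation $\alpha\beta$ lies in $\beta$. *)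

theory Defs
  imports "HOL-Combinatorics.Multiset_Permutations"
begin

text \<open>Permutations are words, i.e.\ distinct lists of natural numbers; the symmetric group on
  \<open>{1,\<dots>,n}\<close> is the set \<open>permutations_of_set {1..n}\<close>.\<close>

definition rho :: "nat list \<Rightarrow> nat \<Rightarrow> nat list" where
  "rho \<pi> x = takeWhile (\<lambda>y. x < y) (tl (dropWhile (\<lambda>y. y \<noteq> x) \<pi>))"

definition jacobi :: "nat list \<Rightarrow> bool" where
  "jacobi \<pi> \<longleftrightarrow> (\<forall>x\<in>set \<pi>. even (length (rho \<pi> x)))"

definition jacobi_perms :: "nat \<Rightarrow> nat list set" where
  "jacobi_perms n = {\<pi> \<in> permutations_of_set {1..n}. jacobi \<pi>}"

text \<open>List positions start at 0, so ascents are at even positions.\<close>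

definition up_down :: "nat list \<Rightarrow> bool" where
  "up_down \<pi> \<longleftrightarrow> (\<forall>i. Suc i < length \<pi> \<longrightarrow>
     (if even i then \<pi> ! i < \<pi> ! Suc i else \<pi> ! i > \<pi> ! Suc i))"

definition up_down_perms :: "nat \<Rightarrow> nat list set" where
  "up_down_perms n = {\<pi> \<in> permutations_of_set {1..n}. up_down \<pi>}"

definition entringer :: "nat \<Rightarrow> nat \<Rightarrow> nat" where
  "entringer n k = card {\<pi> \<in> up_down_perms n. hd \<pi> = k}"

text \<open>The condition on the largest letter of \<open>\<alpha> @ \<beta>\<close> is void for one-letter words.\<close>

inductive andre :: "nat list \<Rightarrow> bool" where
  "andre []"
| "\<lbrakk>distinct (\<alpha> @ y # \<beta>); y = Min (set (\<alpha> @ y # \<beta>)); andre \<alpha>; andre \<beta>;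
    \<alpha> @ \<beta> \<noteq> [] \<longrightarrow> Max (set (\<alpha> @ \<beta>)) \<in> set \<beta>\<rbrakk> \<Longrightarrow> andre (\<alpha> @ y # \<beta>)"

definition andre_perms :: "nat \<Rightarrow> nat list set" where
  "andre_perms n = {\<pi> \<in> permutations_of_set {1..n}. andre \<pi>}"

definition distribution :: "('a \<Rightarrow> 'b) \<Rightarrow> 'a set \<Rightarrow> 'b \<Rightarrow> nat" where
  "distribution f A = (\<lambda>v. card {a \<in> A. f a = v})"

end

theory Submission imports Defs "HOL-Library.Infinite_Set" begin

text \<open>All counts are taken over words on an arbitrary finite set \<open>S\<close> and compared by induction on the size
  of \<open>S\<close>. Let \<open>y\<close> and \<open>z\<close> be its minimum and maximum. A word \<open>\<alpha> y \<beta>\<close> is Jacobi iff \<open>\<alpha>\<close> and \<open>\<beta>\<close> are Jacobi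
  and \<open>\<beta>\<close> has even length; it is up-down iff \<open>\<alpha>\<close> is up-down of even length and \<open>\<beta>\<close> is down-up. As
  there are as many down-up as up-down words, exchanging the two blocks shows that the last letter of
  Jacobi words and the first letter of up-down words satisfy the same recurrence.

  An Andre word \<open>\<alpha> y \<beta>\<close> has \<open>z\<close> outside \<open>\<alpha>\<close>. An up-down word, split at whichever of \<open>y\<close> and \<open>z\<close> comes
  first, has a prefix of even length if this is \<open>y\<close> and of odd length if it is \<open>z\<close>. Together the two
  cases allow every up-down prefix avoiding \<open>y\<close> and \<open>z\<close>, which is again the same recurrence.\<close>

section \<open>Counting words on a finite set\<close>

definition count_perms :: "(nat list \<Rightarrow> bool) \<Rightarrow> nat set \<Rightarrow> nat" where
  "count_perms P S = card {\<pi> \<in> permutations_of_set S. P \<pi>}"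

lemma finite_perms_Collect [simp]: "finite {\<pi> \<in> permutations_of_set S. P \<pi>}"
  by (rule finite_subset[of _ "permutations_of_set S"]) auto

text \<open>All words on \<open>S\<close> have length \<open>card S\<close>, so a parity condition
  on the length can be traded for one on \<open>card S\<close>, which is the same for all
  words.\<close>

lemma count_perms_cong:
  assumes "\<And>\<pi>. \<lbrakk>distinct \<pi>; set \<pi> = S; length \<pi> = card S\<rbrakk> \<Longrightarrow> P \<pi> \<longleftrightarrow> Q \<pi>"
  shows "count_perms P S = count_perms Q S"
proof -
  have "{\<pi> \<in> permutations_of_set S. P \<pi>} = {\<pi> \<in> permutations_of_set S. Q \<pi>}"
    using assms by (intro Collect_cong conj_cong refl)
      (auto simp: permutations_of_setD length_finite_permutations_of_set)
  thus ?thesis by (simp add: count_perms_def)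
qed

lemma count_perms_empty: "count_perms P {} = (if P [] then 1 else 0)"
proof -
  have "{\<pi> \<in> permutations_of_set {}. P \<pi>} = (if P [] then {[]} else {})"
    by auto
  thus ?thesis by (simp add: count_perms_def)
qed

lemma count_perms_False: "count_perms (\<lambda>_. False) S = 0"
  by (simp add: count_perms_def)

lemma count_perms_disj:
  "count_perms P S = count_perms (\<lambda>\<pi>. P \<pi> \<and> R \<pi>) S + count_perms (\<lambda>\<pi>. P \<pi> \<and> \<not> R \<pi>) S"
  unfolding count_perms_def
  by (subst card_Un_disjoint[symmetric])
    (auto simp: conj_disj_distribL[symmetric] simp flip: Collect_disj_eq)

lemma count_perms_by_statistic:
  assumes "finite S" and "\<And>\<pi>. \<lbrakk>distinct \<pi>; set \<pi> = S\<rbrakk> \<Longrightarrow> f \<pi> \<in> S"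
  shows "count_perms P S = (\<Sum>k\<in>S. count_perms (\<lambda>\<pi>. P \<pi> \<and> f \<pi> = k) S)"
proof -
  have "{\<pi> \<in> permutations_of_set S. P \<pi>}
      = (\<Union>k\<in>S. {\<pi> \<in> permutations_of_set S. P \<pi> \<and> f \<pi> = k})"
    using assms(2) by (auto simp: permutations_of_set_def)
  thus ?thesis unfolding count_perms_def
    using assms(1) by (simp only:) (subst card_UN_disjoint, auto)
qed

text \<open>Since \<open>w\<close> occurs exactly once, cutting at \<open>w\<close> is a bijection
  onto triples of a subset \<open>A\<close> of \<open>S - {w}\<close>, a word on \<open>A\<close>
  and a word on the remaining letters. If \<open>P\<close> factors over the two blocks, so does the
  count for each fixed \<open>A\<close>. All recurrences below are instances of this.\<close>

lemma count_perms_split_at: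
  assumes fin: "finite S" and w: "w \<in> S"
    and P: "\<And>\<alpha> \<beta>. \<lbrakk>distinct (\<alpha> @ w # \<beta>); set (\<alpha> @ w # \<beta>) = S\<rbrakk>
                 \<Longrightarrow> P (\<alpha> @ w # \<beta>) \<longleftrightarrow> Q \<alpha> \<and> R \<beta>"
  shows "count_perms P S = (\<Sum>A\<in>Pow (S - {w}). count_perms Q A * count_perms R (S - {w} - A))"
proof -
  let ?X = "\<lambda>A. {\<alpha> \<in> permutations_of_set A. Q \<alpha>} \<times> {\<beta> \<in> permutations_of_set (S - {w} - A). R \<beta>}"
  let ?g = "\<lambda>(\<alpha>, \<beta>). \<alpha> @ w # \<beta>"
  let ?I = "Pow (S - {w})"
  have eq: "{\<pi> \<in> permutations_of_set S. P \<pi>} = ?g ` (\<Union>A\<in>?I. ?X A)"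
  proof (intro equalityI subsetI)
    fix \<pi> assume "\<pi> \<in> {\<pi> \<in> permutations_of_set S. P \<pi>}"
    hence \<pi>: "distinct \<pi>" "set \<pi> = S" "P \<pi>" by (auto simp: permutations_of_set_def)
    then obtain \<alpha> \<beta> where ab: "\<pi> = \<alpha> @ w # \<beta>" using w by (metis split_list)
    have "(\<alpha>, \<beta>) \<in> ?X (set \<alpha>)"
      using \<pi> P[of \<alpha> \<beta>] unfolding ab by (auto simp: permutations_of_set_def)
    moreover have "set \<alpha> \<in> ?I" using \<pi> ab by auto
    ultimately show "\<pi> \<in> ?g ` (\<Union>A\<in>?I. ?X A)" using ab by force
  next
    fix \<pi> assume "\<pi> \<in> ?g ` (\<Union>A\<in>?I. ?X A)"
    then obtain A \<alpha> \<beta> where *: "A \<subseteq> S - {w}" "\<pi> = \<alpha> @ w # \<beta>" "set \<alpha> = A" "distinct \<alpha>" "Q \<alpha>"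
      "set \<beta> = S - {w} - A" "distinct \<beta>" "R \<beta>"
      by (auto simp: permutations_of_set_def)
    hence "distinct (\<alpha> @ w # \<beta>)" "set (\<alpha> @ w # \<beta>) = S" using w by auto
    with P[OF this] * show "\<pi> \<in> {\<pi> \<in> permutations_of_set S. P \<pi>}"
      by (auto simp: permutations_of_set_def)
  qed
  have inj: "inj_on ?g (\<Union>A\<in>?I. ?X A)"
  proof (rule inj_onI, clarify)
    fix A B \<alpha> \<beta> \<alpha>' \<beta>'
    assume "A \<subseteq> S - {w}" "\<alpha> \<in> permutations_of_set A" "\<beta> \<in> permutations_of_set (S - {w} - A)"
      "B \<subseteq> S - {w}" "\<alpha>' \<in> permutations_of_set B" "\<beta>' \<in> permutations_of_set (S - {w} - B)"
      "\<alpha> @ w # \<beta> = \<alpha>' @ w # \<beta>'"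
    moreover from this have "w \<notin> set \<alpha>" "w \<notin> set \<beta>" by (auto simp: permutations_of_set_def)
    ultimately show "\<alpha> = \<alpha>' \<and> \<beta> = \<beta>'" by (simp add: append_Cons_eq_iff)
  qed
  have "card (\<Union>A\<in>?I. ?X A) = (\<Sum>A\<in>?I. card (?X A))"
    using fin by (subst card_UN_disjoint) (auto dest: permutations_of_setD)
  thus ?thesis
    unfolding count_perms_def eq by (simp add: card_image[OF inj] card_cartesian_product)
qed

lemma count_perms_image:
  assumes "inj_on f S" and "\<And>\<pi>. set \<pi> = S \<Longrightarrow> P (map f \<pi>) \<longleftrightarrow> Q \<pi>"
  shows "count_perms P (f ` S) = count_perms Q S"
proof -
  have "{\<pi> \<in> permutations_of_set (f ` S). P \<pi>} = map f ` {\<pi> \<in> permutations_of_set S. Q \<pi>}"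
    unfolding permutations_of_set_image_inj[OF assms(1)]
    using assms(2) by (auto simp: permutations_of_set_def)
  moreover have "inj_on (map f) {\<pi> \<in> permutations_of_set S. Q \<pi>}"
    by (rule inj_on_mapI, rule inj_on_subset[OF assms(1)]) (auto dest: permutations_of_setD)
  ultimately show ?thesis by (simp add: count_perms_def card_image)
qed

section \<open>Alternating words\<close>

text \<open>The flag says whether the first step is an ascent. Both values are needed because a tail
  of an up-down word may be down-up.\<close>

fun alternating :: "bool \<Rightarrow> nat list \<Rightarrow> bool" where
  "alternating b (x # y # zs) \<longleftrightarrow> (if b then x < y else x > y) \<and> alternating (\<not> b) (y # zs)"
| "alternating b _ \<longleftrightarrow> True"

lemma alternating_iff_nth:
  "alternating b \<pi> \<longleftrightarrow> (\<forall>i. Suc i < length \<pi> \<longrightarrow>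
     (if even i = b then \<pi> ! i < \<pi> ! Suc i else \<pi> ! i > \<pi> ! Suc i))"
proof (induction b \<pi> rule: alternating.induct)
  case (1 b x y zs)
  have split: "(\<forall>i. Q i) \<longleftrightarrow> Q 0 \<and> (\<forall>i. Q (Suc i))" for Q :: "nat \<Rightarrow> bool"
    by (metis not0_implies_Suc)
  show ?case
    unfolding alternating.simps 1
    \<comment> \<open>Separating index 0 shifts the other indices by one, which flips their parity
      and matches the flipped flag of the tail.\<close>
    by (subst split[of "\<lambda>i. Suc i < length (x # y # zs) \<longrightarrow> _ i"]) auto
qed auto

lemma up_down_iff_alternating: "up_down \<pi> \<longleftrightarrow> alternating True \<pi>"
  by (simp add: up_down_def alternating_iff_nth)

lemma alternating_map_strict_mono:
  "strict_mono_on S f \<Longrightarrow> set \<pi> \<subseteq> S \<Longrightarrow> alternating b (map f \<pi>) \<longleftrightarrow> alternating b \<pi>"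
  by (induction b \<pi> rule: alternating.induct) (auto simp: strict_mono_on_less)

lemma alternating_map_diff:
  "set \<pi> \<subseteq> {..M} \<Longrightarrow> alternating b (map (\<lambda>x. M - x) \<pi>) \<longleftrightarrow> alternating (\<not> b) \<pi>"
  by (induction b \<pi> rule: alternating.induct) auto

text \<open>Alternation depends only on the relative order of the letters, so the increasing
  relabelling of \<open>S\<close> by \<open>{..<card S}\<close> preserves it.\<close>

lemma count_alternating_card:
  assumes "finite S"
  shows "count_perms (alternating b) S = count_perms (alternating b) {..<card S}"
proof -
  obtain h where h: "bij_betw h {..<card S} S" "strict_mono_on {..<card S} h"
    using ex_bij_betw_strict_mono_card[OF assms] by blast
  have "count_perms (alternating b) (h ` {..<card S}) = count_perms (alternating b) {..<card S}"
    using h by (intro count_perms_image) (auto simp: bij_betw_def alternating_map_strict_mono)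
  thus ?thesis using h by (simp add: bij_betw_def)
qed

text \<open>Complementing each letter \<open>x\<close> to \<open>Max S - x\<close> reverses the
  order and thus exchanges ascents and descents. The image need not be \<open>S\<close> itself, but
  it has the same size, and only the size matters.\<close>

lemma count_alternating_Not:
  assumes "finite S"
  shows "count_perms (alternating b) S = count_perms (alternating (\<not> b)) S"
proof -
  let ?f = "\<lambda>x. Max S - x"
  have le: "S \<subseteq> {..Max S}" using assms by auto
  have inj: "inj_on ?f S" using le by (intro inj_onI) (metis atMost_iff diff_diff_cancel subsetD)
  have "count_perms (alternating b) S = count_perms (alternating b) {..<card S}"
    by (rule count_alternating_card[OF assms])
  also have "\<dots> = count_perms (alternating b) (?f ` S)"
    using count_alternating_card[of "?f ` S" b] assms by (simp add: card_image[OF inj])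
  also have "\<dots> = count_perms (alternating (\<not> b)) S"
    using le by (intro count_perms_image inj alternating_map_diff) auto
  finally show ?thesis .
qed

lemma count_alternating_eq:
  assumes "finite S" "finite S'" "card S = card S'"
  shows "count_perms (alternating b) S = count_perms (alternating b') S'"
proof -
  have "count_perms (alternating b) S = count_perms (alternating b) S'"
    using count_alternating_card[of S b] count_alternating_card[of S' b] assms by simp
  also have "\<dots> = count_perms (alternating b') S'"
    using count_alternating_Not[OF assms(2), of b] by (cases "b' = b") auto
  finally show ?thesis .
qed

section \<open>Cutting a word at its minimum or maximum\<close>

text \<open>The minimum has to be a valley. Counting positions from 0, the valleys of an up-down
  word are the even positions, and the step after the ascent out of a valley is a descent. The
  induction removes two letters at a time, which keeps the flag.\<close>

lemma alternating_split_min: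
  "\<forall>x\<in>set \<alpha> \<union> set \<beta>. w < x \<Longrightarrow>
    alternating True (\<alpha> @ w # \<beta>) \<longleftrightarrow> (alternating True \<alpha> \<and> even (length \<alpha>)) \<and> alternating False \<beta>"
proof (induction \<alpha> rule: induct_list012)
  case 1 thus ?case by (cases \<beta>) auto
next
  case (3 x y zs) thus ?case by (cases zs) auto
qed auto

text \<open>The maximum has to be a peak, and peaks stand at odd positions. The condition
  \<open>\<beta> \<noteq> []\<close> excludes the one-letter word, which is up-down although its
  maximum stands at position 0.\<close>

lemma alternating_split_max:
  "\<forall>x\<in>set \<alpha> \<union> set \<beta>. x < w \<Longrightarrow> \<beta> \<noteq> [] \<Longrightarrow>
    alternating True (\<alpha> @ w # \<beta>) \<longleftrightarrow> (alternating True \<alpha> \<and> odd (length \<alpha>)) \<and> alternating True \<beta>"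
proof (induction \<alpha> rule: induct_list012)
  case 1 thus ?case by (cases \<beta>) auto
next
  case (2 x) thus ?case by (cases \<beta>) auto
next
  case (3 x y zs) thus ?case by (cases zs) auto
qed

text \<open>The minimum stops every run that starts in \<open>\<alpha>\<close>, its own run is all
  of \<open>\<beta>\<close>, and runs starting in \<open>\<beta>\<close> do not see what stands to
  their left.\<close>

lemma jacobi_split_min:
  assumes "distinct (\<alpha> @ w # \<beta>)" and less: "\<forall>x\<in>set \<alpha> \<union> set \<beta>. w < x"
  shows "jacobi (\<alpha> @ w # \<beta>) \<longleftrightarrow> jacobi \<alpha> \<and> jacobi \<beta> \<and> even (length \<beta>)"
proof -
  have 1: "rho (\<alpha> @ w # \<beta>) x = rho \<alpha> x" if "x \<in> set \<alpha>" for x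
  proof -
    have ne: "dropWhile (\<lambda>y. y \<noteq> x) \<alpha> \<noteq> []" using that by auto
    have "dropWhile (\<lambda>y. y \<noteq> x) (\<alpha> @ w # \<beta>) = dropWhile (\<lambda>y. y \<noteq> x) \<alpha> @ w # \<beta>"
      using that by (intro dropWhile_append1) auto
    moreover have "\<not> x < w" using less that by (meson UnCI not_less_iff_gr_or_eq)
    ultimately show ?thesis using ne by (simp add: rho_def takeWhile_tail)
  qed
  have 2: "rho (\<alpha> @ w # \<beta>) w = \<beta>"
  proof -
    have "dropWhile (\<lambda>y. y \<noteq> w) (\<alpha> @ w # \<beta>) = w # \<beta>"
      using assms(1) by (subst dropWhile_append2) auto
    thus ?thesis using less by (simp add: rho_def)
  qed
  have 3: "rho (\<alpha> @ w # \<beta>) x = rho \<beta> x" if "x \<in> set \<beta>" for x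
  proof -
    have "dropWhile (\<lambda>y. y \<noteq> x) (\<alpha> @ w # \<beta>) = dropWhile (\<lambda>y. y \<noteq> x) (w # \<beta>)"
      using assms(1) that by (intro dropWhile_append2) auto
    thus ?thesis using assms(1) that by (auto simp: rho_def)
  qed
  have "jacobi (\<alpha> @ w # \<beta>) \<longleftrightarrow> (\<forall>x\<in>set \<alpha>. even (length (rho (\<alpha> @ w # \<beta>) x)))
      \<and> even (length (rho (\<alpha> @ w # \<beta>) w)) \<and> (\<forall>x\<in>set \<beta>. even (length (rho (\<alpha> @ w # \<beta>) x)))"
    by (simp add: jacobi_def ball_Un conj_left_commute)
  thus ?thesis by (simp add: jacobi_def 1 2 3 cong: ball_cong) blast
qed

text \<open>The introduction rule cuts a word at its minimum. As this letter occurs once, the cut is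
  unique and the rule can be read backwards.\<close>

lemma andre_split_min:
  assumes "distinct (\<alpha> @ w # \<beta>)" and less: "\<forall>x\<in>set \<alpha> \<union> set \<beta>. w < x"
  shows "andre (\<alpha> @ w # \<beta>) \<longleftrightarrow>
    andre \<alpha> \<and> andre \<beta> \<and> (\<alpha> @ \<beta> \<noteq> [] \<longrightarrow> Max (set (\<alpha> @ \<beta>)) \<in> set \<beta>)" (is "?L \<longleftrightarrow> ?R")
proof -
  have min: "w = Min (set (\<alpha> @ w # \<beta>))"
    using less by (intro Min_eqI[symmetric]) (auto intro: less_imp_le)
  show ?thesis
  proof
    assume ?L
    thus ?R
    proof cases
      case (2 \<alpha>' y \<beta>')
      have "y = w" using 2(1,3) min by simp
      hence "\<alpha>' = \<alpha> \<and> \<beta>' = \<beta>"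
        using append_Cons_eq_iff[of w \<alpha>' \<beta>' \<alpha> \<beta>] 2(1,2) by auto
      thus ?R using 2 by simp
    qed simp
  next
    assume ?R
    thus ?L using assms(1) min by (intro andre.intros(2)) auto
  qed
qed

section \<open>From refined counts to total counts\<close>

text \<open>Summing the refined counts over all values in \<open>S\<close> gives the totals. The
  empty word is treated apart because it has no first or last letter. Inside the inductions below
  this turns the hypothesis about a marked letter into one about the unmarked block.\<close>

lemma count_perms_eq_by_statistics:
  assumes "finite S" and "S = {} \<Longrightarrow> P [] \<longleftrightarrow> Q []"
    and f: "\<And>\<pi>. \<pi> \<noteq> [] \<Longrightarrow> f \<pi> \<in> set \<pi>" and g: "\<And>\<pi>. \<pi> \<noteq> [] \<Longrightarrow> g \<pi> \<in> set \<pi>"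
    and eq: "\<And>k. S \<noteq> {} \<Longrightarrow> count_perms (\<lambda>\<pi>. P \<pi> \<and> f \<pi> = k) S = count_perms (\<lambda>\<pi>. Q \<pi> \<and> g \<pi> = k) S"
  shows "count_perms P S = count_perms Q S"
proof (cases "S = {}")
  case True
  thus ?thesis using assms(2) by (simp add: count_perms_empty)
next
  case False
  hence "count_perms P S = (\<Sum>k\<in>S. count_perms (\<lambda>\<pi>. P \<pi> \<and> f \<pi> = k) S)"
    using assms(1) f by (intro count_perms_by_statistic) auto
  also have "\<dots> = (\<Sum>k\<in>S. count_perms (\<lambda>\<pi>. Q \<pi> \<and> g \<pi> = k) S)"
    using eq False by simp
  also have "\<dots> = count_perms Q S"
    using assms(1) g False by (intro count_perms_by_statistic[symmetric]) auto
  finally show ?thesis .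
qed

lemma Min_less_rest:
  assumes "distinct (\<alpha> @ w # \<beta>)" "set (\<alpha> @ w # \<beta>) = S" "finite S" "w = Min S"
  shows "\<forall>x\<in>set \<alpha> \<union> set \<beta>. w < x"
proof
  fix x assume x: "x \<in> set \<alpha> \<union> set \<beta>"
  hence "x \<noteq> w" and "x \<in> S" using assms(1,2) by auto
  with Min_le[OF assms(3)] show "w < x" unfolding assms(4) by (simp add: order_less_le)
qed

lemma Max_greater_rest:
  assumes "distinct (\<alpha> @ w # \<beta>)" "set (\<alpha> @ w # \<beta>) = S" "finite S" "w = Max S"
  shows "\<forall>x\<in>set \<alpha> \<union> set \<beta>. x < w"
proof
  fix x assume x: "x \<in> set \<alpha> \<union> set \<beta>"
  hence "x \<noteq> w" and "x \<in> S" using assms(1,2) by auto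
  with Max_ge[OF assms(3)] show "x < w" unfolding assms(4) by (simp add: order_less_le)
qed

section \<open>Last letters of Jacobi words\<close>

text \<open>The marked letter lies in the right block of a Jacobi word and in the left block of an
  up-down word, and these are exactly the blocks of even length. The other block is unrestricted in
  length and enters only through its total count.\<close>

lemma count_jacobi_last_eq_up_down_hd:
  assumes "finite S" "S \<noteq> {}"
  shows "count_perms (\<lambda>\<pi>. jacobi \<pi> \<and> last \<pi> = k) S = count_perms (\<lambda>\<pi>. alternating True \<pi> \<and> hd \<pi> = k) S"
  using assms
proof (induction "card S" arbitrary: S k rule: less_induct)
  case less
  define y where "y = Min S"
  let ?S = "S - {y}"
  have y: "y \<in> S" using less.prems by (simp add: y_def)
  have IH: "count_perms (\<lambda>\<pi>. jacobi \<pi> \<and> last \<pi> = k) A = count_perms (\<lambda>\<pi>. alternating True \<pi> \<and> hd \<pi> = k) A"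
    if "A \<subseteq> ?S" "A \<noteq> {}" for A k
    using that y less.prems(1)
    by (intro less.hyps psubset_card_mono finite_subset[OF _ less.prems(1)]) auto
  have fin: "finite A" if "A \<subseteq> ?S" for A using that less.prems(1) by (auto intro: finite_subset)
  have total: "count_perms jacobi A = count_perms (alternating False) A" if "A \<subseteq> ?S" for A
  proof -
    have "count_perms jacobi A = count_perms (alternating True) A"
      by (rule count_perms_eq_by_statistics[OF fin[OF that] _ _ _ IH[OF that]])
        (simp_all add: jacobi_def)
    thus ?thesis using count_alternating_eq[of A A] fin[OF that] by simp
  qed
  \<comment> \<open>Attaching \<open>y\<close> makes the marked letter \<open>y\<close> itself when
    the block is empty.\<close>
  have block: "count_perms (\<lambda>\<beta>. (jacobi \<beta> \<and> even (length \<beta>)) \<and> last (y # \<beta>) = k) A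
      = count_perms (\<lambda>\<alpha>. (alternating True \<alpha> \<and> even (length \<alpha>)) \<and> hd (\<alpha> @ [y]) = k) A"
    if "A \<subseteq> ?S" for A
  proof (cases "A = {}")
    case True
    thus ?thesis by (simp add: count_perms_empty jacobi_def)
  next
    case False
    have "count_perms (\<lambda>\<beta>. (jacobi \<beta> \<and> even (length \<beta>)) \<and> last (y # \<beta>) = k) A
        = count_perms (\<lambda>\<beta>. even (card A) \<and> jacobi \<beta> \<and> last \<beta> = k) A"
      using False by (intro count_perms_cong) auto
    also have "\<dots> = count_perms (\<lambda>\<beta>. even (card A) \<and> alternating True \<beta> \<and> hd \<beta> = k) A"
      using IH[OF that False] by (cases "even (card A)") auto
    also have "\<dots> = count_perms (\<lambda>\<alpha>. (alternating True \<alpha> \<and> even (length \<alpha>)) \<and> hd (\<alpha> @ [y]) = k) A"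
      using False by (intro count_perms_cong) auto
    finally show ?thesis .
  qed
  have "count_perms (\<lambda>\<pi>. jacobi \<pi> \<and> last \<pi> = k) S
      = (\<Sum>A\<in>Pow ?S. count_perms jacobi A
          * count_perms (\<lambda>\<beta>. (jacobi \<beta> \<and> even (length \<beta>)) \<and> last (y # \<beta>) = k) (?S - A))"
  proof (rule count_perms_split_at[OF less.prems(1) y])
    fix \<alpha> \<beta> assume d: "distinct (\<alpha> @ y # \<beta>)" and S: "set (\<alpha> @ y # \<beta>) = S"
    show "jacobi (\<alpha> @ y # \<beta>) \<and> last (\<alpha> @ y # \<beta>) = k \<longleftrightarrow>
        jacobi \<alpha> \<and> (jacobi \<beta> \<and> even (length \<beta>)) \<and> last (y # \<beta>) = k"
      unfolding jacobi_split_min[OF d Min_less_rest[OF d S less.prems(1) y_def]] by auto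
  qed
  \<comment> \<open>Replacing \<open>A\<close> by its complement in \<open>?S\<close> exchanges the
    roles of the two blocks.\<close>
  also have "\<dots> = (\<Sum>A\<in>Pow ?S. count_perms jacobi (?S - A)
          * count_perms (\<lambda>\<beta>. (jacobi \<beta> \<and> even (length \<beta>)) \<and> last (y # \<beta>) = k) A)"
    by (rule sum.reindex_bij_witness[where i = "\<lambda>A. ?S - A" and j = "\<lambda>A. ?S - A"])
       (auto simp: double_diff)
  also have "\<dots> = (\<Sum>A\<in>Pow ?S.
          count_perms (\<lambda>\<alpha>. (alternating True \<alpha> \<and> even (length \<alpha>)) \<and> hd (\<alpha> @ [y]) = k) A
          * count_perms (alternating False) (?S - A))"
  proof (intro sum.cong refl)
    fix A assume "A \<in> Pow ?S"
    hence "A \<subseteq> ?S" and "?S - A \<subseteq> ?S" by auto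
    thus "count_perms jacobi (?S - A)
          * count_perms (\<lambda>\<beta>. (jacobi \<beta> \<and> even (length \<beta>)) \<and> last (y # \<beta>) = k) A
        = count_perms (\<lambda>\<alpha>. (alternating True \<alpha> \<and> even (length \<alpha>)) \<and> hd (\<alpha> @ [y]) = k) A
          * count_perms (alternating False) (?S - A)"
      by (simp only: block total mult.commute)
  qed
  also have "\<dots> = count_perms (\<lambda>\<pi>. alternating True \<pi> \<and> hd \<pi> = k) S"
  proof (rule count_perms_split_at[OF less.prems(1) y, symmetric])
    fix \<alpha> \<beta> assume d: "distinct (\<alpha> @ y # \<beta>)" and S: "set (\<alpha> @ y # \<beta>) = S"
    show "alternating True (\<alpha> @ y # \<beta>) \<and> hd (\<alpha> @ y # \<beta>) = k \<longleftrightarrow>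
        ((alternating True \<alpha> \<and> even (length \<alpha>)) \<and> hd (\<alpha> @ [y]) = k) \<and> alternating False \<beta>"
      unfolding alternating_split_min[OF Min_less_rest[OF d S less.prems(1) y_def]]
      by (auto simp: hd_append)
  qed
  finally show ?case .
qed

section \<open>First letters of Andre words\<close>

text \<open>The marked letter now lies in the left block on both sides. For a fixed letter set of
  that block, the right block has the same size whether the cut is made at the minimum or at the
  maximum, so a common factor can be taken out.\<close>

lemma count_andre_hd_eq_up_down_hd:
  assumes "finite S" "S \<noteq> {}"
  shows "count_perms (\<lambda>\<pi>. andre \<pi> \<and> hd \<pi> = k) S = count_perms (\<lambda>\<pi>. alternating True \<pi> \<and> hd \<pi> = k) S"
  using assms
proof (induction "card S" arbitrary: S k rule: less_induct)
  case less
  define y where "y = Min S"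
  define z where "z = Max S"
  let ?S = "S - {y}"
  let ?T = "S - {y, z}"
  have y: "y \<in> S" and z: "z \<in> S" using less.prems by (simp_all add: y_def z_def)
  have IH: "count_perms (\<lambda>\<pi>. andre \<pi> \<and> hd \<pi> = k) A = count_perms (\<lambda>\<pi>. alternating True \<pi> \<and> hd \<pi> = k) A"
    if "A \<subseteq> ?S" "A \<noteq> {}" for A k
    using that y less.prems(1)
    by (intro less.hyps psubset_card_mono finite_subset[OF _ less.prems(1)]) auto
  have fin: "finite A" if "A \<subseteq> S" for A using that less.prems(1) by (auto intro: finite_subset)
  have total: "count_perms andre A = count_perms (alternating False) A" if "A \<subseteq> ?S" for A
  proof -
    have "finite A" using that by (intro fin) auto
    hence "count_perms andre A = count_perms (alternating True) A"
      by (rule count_perms_eq_by_statistics[OF _ _ _ _ IH[OF that]]) (simp_all add: andre.intros)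
    thus ?thesis using count_alternating_eq[of A A] \<open>finite A\<close> by simp
  qed
  \<comment> \<open>A condition that \<open>u\<close> is absent from the left block becomes a
    restriction of the index set: subsets containing \<open>u\<close> contribute 0, and on the
    others the condition always holds.\<close>
  have restrict: "(\<Sum>A\<in>Pow (S - {v}). count_perms (\<lambda>\<alpha>. Q \<alpha> \<and> u \<notin> set \<alpha>) A * R A)
      = (\<Sum>A\<in>Pow (S - {v, u}). count_perms Q A * R A)" for u v Q and R :: "nat set \<Rightarrow> nat"
  proof (intro sum.mono_neutral_cong_right)
    show "\<forall>A\<in>Pow (S - {v}) - Pow (S - {v, u}). count_perms (\<lambda>\<alpha>. Q \<alpha> \<and> u \<notin> set \<alpha>) A * R A = 0"
    proof
      fix A assume "A \<in> Pow (S - {v}) - Pow (S - {v, u})"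
      hence "u \<in> A" by auto
      hence "count_perms (\<lambda>\<alpha>. Q \<alpha> \<and> u \<notin> set \<alpha>) A = count_perms (\<lambda>_. False) A"
        by (intro count_perms_cong) auto
      thus "count_perms (\<lambda>\<alpha>. Q \<alpha> \<and> u \<notin> set \<alpha>) A * R A = 0" by (simp add: count_perms_False)
    qed
    show "count_perms (\<lambda>\<alpha>. Q \<alpha> \<and> u \<notin> set \<alpha>) A * R A = count_perms Q A * R A"
      if "A \<in> Pow (S - {v, u})" for A
      using that by (intro arg_cong2[where f = times] count_perms_cong) auto
  qed (use less.prems in auto)
  have "count_perms (\<lambda>\<pi>. andre \<pi> \<and> hd \<pi> = k) S
      = (\<Sum>A\<in>Pow ?S. count_perms (\<lambda>\<alpha>. (andre \<alpha> \<and> hd (\<alpha> @ [y]) = k) \<and> z \<notin> set \<alpha>) A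
          * count_perms andre (?S - A))"
  proof (rule count_perms_split_at[OF less.prems(1) y])
    fix \<alpha> \<beta> assume d: "distinct (\<alpha> @ y # \<beta>)" and S: "set (\<alpha> @ y # \<beta>) = S"
    note lt = Min_less_rest[OF d S less.prems(1) y_def]
    \<comment> \<open>Removing the minimum from a word with at least two letters keeps its maximum
      \<open>z\<close>. For a one-letter word both sides hold.\<close>
    have "(\<alpha> @ \<beta> \<noteq> [] \<longrightarrow> Max (set (\<alpha> @ \<beta>)) \<in> set \<beta>) \<longleftrightarrow> z \<notin> set \<alpha>"
    proof (cases "\<alpha> @ \<beta> = []")
      case False
      have ne: "set (\<alpha> @ \<beta>) \<noteq> {}" using False by (simp only: set_empty) simp
      have "Max (set (\<alpha> @ \<beta>)) \<in> set (\<alpha> @ \<beta>)" using ne by (intro Max_in) auto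
      moreover from this have "y < Max (set (\<alpha> @ \<beta>))" using lt by auto
      moreover have "S = insert y (set (\<alpha> @ \<beta>))" using S by auto
      ultimately have "z = Max (set (\<alpha> @ \<beta>))"
        using ne unfolding z_def by (simp add: max_def)
      thus ?thesis using False d \<open>Max (set (\<alpha> @ \<beta>)) \<in> set (\<alpha> @ \<beta>)\<close> by auto
    qed auto
    thus "andre (\<alpha> @ y # \<beta>) \<and> hd (\<alpha> @ y # \<beta>) = k \<longleftrightarrow>
        ((andre \<alpha> \<and> hd (\<alpha> @ [y]) = k) \<and> z \<notin> set \<alpha>) \<and> andre \<beta>"
      using andre_split_min[OF d lt] by (auto simp: hd_append)
  qed
  also have "\<dots> = (\<Sum>A\<in>Pow ?T. count_perms (\<lambda>\<alpha>. andre \<alpha> \<and> hd (\<alpha> @ [y]) = k) A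
          * count_perms andre (?S - A))"
    by (rule restrict)
  finally have andre: "count_perms (\<lambda>\<pi>. andre \<pi> \<and> hd \<pi> = k) S = \<dots>" .
  show ?case
  \<comment> \<open>If minimum and maximum coincide, there is only one word and no order between two
    letters to distinguish, so this case is checked directly.\<close>
  proof (cases "y = z")
    case True
    have "S = {y}"
    proof -
      have "x = y" if "x \<in> S" for x
        using Min_le[OF less.prems(1) that] Max_ge[OF less.prems(1) that] True
        unfolding y_def z_def by simp
      thus ?thesis using y by blast
    qed
    have "andre [y]" using andre.intros(2)[of "[]" y "[]"] by (simp add: andre.intros(1))
    show ?thesis
    proof (rule count_perms_cong)
      fix \<pi> assume \<pi>: "set \<pi> = S" "length \<pi> = card S"
      obtain a where "\<pi> = [a]" using \<pi>(2) unfolding \<open>S = {y}\<close> by (cases \<pi>) auto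
      with \<pi>(1) have "\<pi> = [y]" unfolding \<open>S = {y}\<close> by simp
      thus "andre \<pi> \<and> hd \<pi> = k \<longleftrightarrow> alternating True \<pi> \<and> hd \<pi> = k" using \<open>andre [y]\<close> by simp
    qed
  next
    case False
    let ?E = "\<lambda>\<alpha>. (alternating True \<alpha> \<and> even (length \<alpha>)) \<and> hd (\<alpha> @ [y]) = k"
    let ?O = "\<lambda>\<alpha>. (alternating True \<alpha> \<and> odd (length \<alpha>)) \<and> hd (\<alpha> @ [z]) = k"
    \<comment> \<open>For a word on \<open>S\<close> this says that \<open>y\<close> comes before
      \<open>z\<close>.\<close>
    let ?R = "\<lambda>\<pi>. z \<notin> set (takeWhile (\<lambda>x. x \<noteq> y) \<pi>)"
    have block: "count_perms (\<lambda>\<alpha>. andre \<alpha> \<and> hd (\<alpha> @ [y]) = k) A = count_perms ?E A + count_perms ?O A"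
      if A: "A \<subseteq> ?T" for A
    \<comment> \<open>The empty block has even length, so it is counted by \<open>?E\<close> alone,
      with \<open>y\<close> as the marked letter.\<close>
    proof (cases "A = {}")
      case True
      thus ?thesis by (simp add: count_perms_empty andre.intros)
    next
      case False
      have "count_perms (\<lambda>\<alpha>. andre \<alpha> \<and> hd (\<alpha> @ [y]) = k) A = count_perms (\<lambda>\<alpha>. andre \<alpha> \<and> hd \<alpha> = k) A"
        using False by (intro count_perms_cong) (auto simp: hd_append)
      also have "\<dots> = count_perms (\<lambda>\<alpha>. alternating True \<alpha> \<and> hd \<alpha> = k) A"
        using A False by (intro IH) auto
      also have "\<dots> = count_perms ?E A + count_perms ?O A"
        using False
        by (subst count_perms_disj[where R = "\<lambda>\<alpha>. even (length \<alpha>)"])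
           (intro arg_cong2[where f = plus] count_perms_cong; auto simp: hd_append)
      finally show ?thesis .
    qed
    have "count_perms (\<lambda>\<pi>. (alternating True \<pi> \<and> hd \<pi> = k) \<and> ?R \<pi>) S
        = (\<Sum>A\<in>Pow ?S. count_perms (\<lambda>\<alpha>. ?E \<alpha> \<and> z \<notin> set \<alpha>) A * count_perms (alternating False) (?S - A))"
    proof (rule count_perms_split_at[OF less.prems(1) y])
      fix \<alpha> \<beta> assume d: "distinct (\<alpha> @ y # \<beta>)" and S: "set (\<alpha> @ y # \<beta>) = S"
      have "takeWhile (\<lambda>x. x \<noteq> y) (\<alpha> @ y # \<beta>) = \<alpha>"
        using d by (subst takeWhile_append2) auto
      thus "(alternating True (\<alpha> @ y # \<beta>) \<and> hd (\<alpha> @ y # \<beta>) = k) \<and> ?R (\<alpha> @ y # \<beta>) \<longleftrightarrow>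
          (?E \<alpha> \<and> z \<notin> set \<alpha>) \<and> alternating False \<beta>"
        using alternating_split_min[OF Min_less_rest[OF d S less.prems(1) y_def]]
        by (auto simp: hd_append)
    qed
    also have "\<dots> = (\<Sum>A\<in>Pow ?T. count_perms ?E A * count_perms (alternating False) (?S - A))"
      by (rule restrict)
    finally have min_first: "count_perms (\<lambda>\<pi>. (alternating True \<pi> \<and> hd \<pi> = k) \<and> ?R \<pi>) S = \<dots>" .
    have "count_perms (\<lambda>\<pi>. (alternating True \<pi> \<and> hd \<pi> = k) \<and> \<not> ?R \<pi>) S
        = (\<Sum>A\<in>Pow (S - {z}). count_perms (\<lambda>\<alpha>. ?O \<alpha> \<and> y \<notin> set \<alpha>) A
            * count_perms (alternating True) (S - {z} - A))"
    proof (rule count_perms_split_at[OF less.prems(1) z])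
      fix \<alpha> \<beta> assume d: "distinct (\<alpha> @ z # \<beta>)" and S: "set (\<alpha> @ z # \<beta>) = S"
      show "(alternating True (\<alpha> @ z # \<beta>) \<and> hd (\<alpha> @ z # \<beta>) = k) \<and> \<not> ?R (\<alpha> @ z # \<beta>) \<longleftrightarrow>
          (?O \<alpha> \<and> y \<notin> set \<alpha>) \<and> alternating True \<beta>"
      \<comment> \<open>If \<open>y\<close> lies in \<open>\<alpha>\<close>, it precedes
        \<open>z\<close> and both sides are false. Otherwise the prefix before \<open>y\<close> runs
        past \<open>z\<close>, and \<open>y\<close> must lie in \<open>\<beta>\<close>, which is
        therefore nonempty.\<close>
      proof (cases "y \<in> set \<alpha>")
        case True
        hence "takeWhile (\<lambda>x. x \<noteq> y) (\<alpha> @ z # \<beta>) = takeWhile (\<lambda>x. x \<noteq> y) \<alpha>"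
          by (intro takeWhile_append1) auto
        thus ?thesis using True d by (auto dest: set_takeWhileD)
      next
        case notin: False
        hence "takeWhile (\<lambda>x. x \<noteq> y) (\<alpha> @ z # \<beta>) = \<alpha> @ takeWhile (\<lambda>x. x \<noteq> y) (z # \<beta>)"
          by (intro takeWhile_append2) auto
        moreover have "\<beta> \<noteq> []" using S y notin False by auto
        ultimately show ?thesis
          using notin False alternating_split_max[OF Max_greater_rest[OF d S less.prems(1) z_def]]
          by (auto simp: hd_append)
      qed
    qed
    also have "\<dots> = (\<Sum>A\<in>Pow (S - {z, y}). count_perms ?O A * count_perms (alternating True) (S - {z} - A))"
      by (rule restrict)
    \<comment> \<open>The right block contains \<open>y\<close> on one side and \<open>z\<close> on
      the other. The sizes agree, and alternating words are counted by size alone, whatever the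
      first step.\<close>
    also have "\<dots> = (\<Sum>A\<in>Pow ?T. count_perms ?O A * count_perms (alternating False) (?S - A))"
    proof (intro sum.cong arg_cong2[where f = times] refl)
      fix A assume "A \<in> Pow ?T"
      hence "A \<subseteq> S - {z}" "A \<subseteq> ?S" "finite A" using fin[of A] by auto
      hence "card (S - {z} - A) = card (?S - A)"
        using y z by (simp add: card_Diff_subset)
      thus "count_perms (alternating True) (S - {z} - A) = count_perms (alternating False) (?S - A)"
        using less.prems(1) by (intro count_alternating_eq) auto
    qed auto
    finally have max_first: "count_perms (\<lambda>\<pi>. (alternating True \<pi> \<and> hd \<pi> = k) \<and> \<not> ?R \<pi>) S = \<dots>" .
    have "count_perms (\<lambda>\<pi>. andre \<pi> \<and> hd \<pi> = k) S
        = (\<Sum>A\<in>Pow ?T. (count_perms ?E A + count_perms ?O A) * count_perms (alternating False) (?S - A))"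
      unfolding andre
    proof (intro sum.cong refl arg_cong2[where f = times])
      fix A assume "A \<in> Pow ?T"
      thus "count_perms (\<lambda>\<alpha>. andre \<alpha> \<and> hd (\<alpha> @ [y]) = k) A = count_perms ?E A + count_perms ?O A"
        by (intro block) auto
      show "count_perms andre (?S - A) = count_perms (alternating False) (?S - A)"
        by (intro total) auto
    qed
    also have "\<dots> = count_perms (\<lambda>\<pi>. alternating True \<pi> \<and> hd \<pi> = k) S"
      unfolding count_perms_disj[of "\<lambda>\<pi>. alternating True \<pi> \<and> hd \<pi> = k" S ?R] min_first max_first
      by (simp only: distrib_right sum.distrib)
    finally show ?thesis .
  qed
qed

theorem theorem2p7:
  fixes n :: nat
  assumes "n \<ge> 1"
  shows "(\<forall>k\<ge>1. card {\<pi> \<in> jacobi_perms n. last \<pi> = k} = entringer n k)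
    \<and> distribution last (jacobi_perms n) = distribution hd (up_down_perms n)
    \<and> distribution last (jacobi_perms n) = distribution hd (andre_perms n)"
proof -
  \<comment> \<open>Nonemptiness matters: for the empty word \<open>last\<close> and
    \<open>hd\<close> would be unspecified values.\<close>
  have *: "finite {1..n}" "{1..n} \<noteq> {}" using assms by auto
  have "card {\<pi> \<in> jacobi_perms n. last \<pi> = k} = card {\<pi> \<in> up_down_perms n. hd \<pi> = k}"
    "card {\<pi> \<in> andre_perms n. hd \<pi> = k} = card {\<pi> \<in> up_down_perms n. hd \<pi> = k}" for k
    using count_jacobi_last_eq_up_down_hd[OF *, of k] count_andre_hd_eq_up_down_hd[OF *, of k]
    by (simp_all add: count_perms_def jacobi_perms_def up_down_perms_def andre_perms_def
        up_down_iff_alternating)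
  thus ?thesis by (simp add: entringer_def distribution_def)
qed

end
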